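(* Let $(\Omega,\mathcal{F},(\mathcal{F}_t)_{t\ge 0},\mathbb{P})$ be a filtered probability space satisfying property (NP), let $(X_t)_{t\ge 0}$ be a submartingale of class $(\Sigma)$ on it with decomposition $X_t=N_t+A_t$, and let $\mathcal{Q}$ be the associated $\sigma$-finite measure. Let $F$ be a nonnegative, $\mathcal{Q}$-integrable functional on $(\Omega,\mathcal{F})$. Then on the set $\{A_\infty=\infty\}$, the martingale $M_t(F)$ tends $\mathbb{P}$-almost surely to zero when $t$ goes to infinity.
   Context: Notation: $\mathbb{P}[Y]$ denotes the expectation of $Y$ under $\mathbb{P}$ (and $\mathcal{Q}[Y]$ the integral of $Y$ under $\mathcal{Q}$); for an increasing process $(A_t)$, $A_\infty=\lim_{t\to\infty}A_t$. Class $(\Sigma)$: a nonnegative submartingale $(X_t)_{t\ge0}$ is of class $(\Sigma)$ iff $X_t=N_t+A_t$ where $(N_t)$ and $(A_t)$ are adapted, $(N_t)$ is a càdlàg martingale, $(A_t)$ is a continuous increasing process with $A_0=0$, and the measure $(dA_t)$ is carried by $\{t\ge0: X_t=0\}$. (In particular $X_t$ is integrable for all $t$.) Natural conditions: $(\Omega,\mathcal{F},(\mathcal{F}_t),\mathbb{P})$ satisfies the natural conditions iff $(\mathcal{F}_t)$ is right-continuous and, for all $t\ge0$ and every $\mathbb{P}$-negligible $A\in\mathcal{F}_t$, all subsets of $A$ belong to $\mathcal{F}_0$. The natural enlargement of a filtered probability space is its smallest extension (same $\Omega$, larger $\sigma$-algebras, extended probability) satisfying the natural conditions; it exists and is unique.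 Property (P): a filtered measurable space $(\Omega,\mathcal{F},(\mathcal{F}_t))$ with $\mathcal{F}=\bigvee_{t\ge0}\mathcal{F}_t$ satisfies (P) iff (i) each $\mathcal{F}_t$ is countably generated; (ii) for each $t$ there are a Polish space $\Omega_t$ and a surjection $\pi_t:\Omega\to\Omega_t$ such that $\mathcal{F}_t$ is the $\sigma$-algebra of inverse images under $\pi_t$ of Borel sets of $\Omega_t$, and for all $B\in\mathcal{F}_t$, $\omega\in\Omega$, $\pi_t(\omega)\in\pi_t(B)$ implies $\omega\in B$; (iii) if $(\omega_n)_{n\ge0}$ is a sequence in $\Omega$ with $\bigcap_{n=0}^N A_n(\omega_n)\ne\emptyset$ for all $N\ge0$, where $A_n(\omega_n)$ is the intersection of the sets of $\mathcal{F}_n$ containing $\omega_n$, then $\bigcap_{n=0}^\infty A_n(\omega_n)\neq\emptyset$. Property (NP): a filtered probability space satisfies (NP) iff it is the natural enlargement of a filtered probability space $(\Omega,\mathcal{F}^0,(\mathcal{F}^0_t),\mathbb{P}^0)$ such that $(\Omega,\mathcal{F}^0,(\mathcal{F}^0_t))$ satisfies (P). In this case $\mathcal{F}=\bigvee_{t\ge 0}\mathcal{F}_t$. The measure $\mathcal{Q}$ (known theorem): if $(X_t)$ is a submartingale of class $(\Sigma)$ on a space satisfying (NP) and $g:=\sup\{t\ge0: X_t=0\}$ (with $\sup\emptyset=0$), there is a unique $\sigma$-finite measure $\mathcal{Q}$ on $(\Omega,\mathcal{F})$ such that $\mathcal{Q}[g=\infty]=0$ and, for all $t\ge0$ and all bounded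 $\mathcal{F}_t$-measurable $F_t$, $\mathcal{Q}[F_t\mathds{1}_{g\le t}]=\mathbb{P}[F_tX_t]$. The martingale $M_t(F)$: for a nonnegative, $\mathcal{Q}$-integrable functional $F$ on $(\Omega,\mathcal{F})$, $(M_t(F))_{t\ge0}$ denotes the càdlàg $\mathbb{P}$-martingale, unique up to indistinguishability, such that $\mathcal{Q}[F\,\Gamma_t]=\mathbb{P}[\Gamma_tM_t(F)]$ for all $t\ge0$ and all bounded $\mathcal{F}_t$-measurable $\Gamma_t$. *)

theory Defs
  imports "HOL-Probability.Probability"
begin

(* Time is [0,\<infinity>), represented by the nonnegative reals: every condition on a filtration or a
   process is restricted to times t \<ge> 0, and values at negative times are irrelevant. The members
   FF t of a filtration only matter through their space and their sets. *)

section \<open>Filtered spaces\<close>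

locale filtered_space =
  fixes M :: "'a measure" and FF :: "real \<Rightarrow> 'a measure"
  assumes subalgebra_FF: "\<And>t. 0 \<le> t \<Longrightarrow> subalgebra M (FF t)"
    and FF_mono: "\<And>s t. 0 \<le> s \<Longrightarrow> s \<le> t \<Longrightarrow> sets (FF s) \<subseteq> sets (FF t)"

locale filtered_prob_space = filtered_space P FF + prob_space P
  for P :: "'a measure" and FF :: "real \<Rightarrow> 'a measure"

section \<open>Natural conditions and natural enlargement\<close>

(* In contrast to the usual conditions, only the subsets of negligible sets belonging to some FF t
   are required to lie in FF 0, not the subsets of all P-null sets. *)
definition natural_conditions :: "'a measure \<Rightarrow> (real \<Rightarrow> 'a measure) \<Rightarrow> bool" where
  "natural_conditions P FF \<longleftrightarrow>
     filtered_prob_space P FF \<and>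
     (\<forall>t\<ge>0. sets (FF t) = (\<Inter>s\<in>{t<..}. sets (FF s))) \<and>
     (\<forall>t\<ge>0. \<forall>A\<in>sets (FF t). emeasure P A = 0 \<longrightarrow> (\<forall>B. B \<subseteq> A \<longrightarrow> B \<in> sets (FF 0)))"

definition extends_filtered_prob ::
  "'a measure \<Rightarrow> (real \<Rightarrow> 'a measure) \<Rightarrow> 'a measure \<Rightarrow> (real \<Rightarrow> 'a measure) \<Rightarrow> bool" where
  "extends_filtered_prob P' FF' P FF \<longleftrightarrow>
     filtered_prob_space P FF \<and> filtered_prob_space P' FF' \<and>
     space P' = space P \<and> sets P \<subseteq> sets P' \<and>
     (\<forall>t\<ge>0. sets (FF t) \<subseteq> sets (FF' t)) \<and>
     (\<forall>A\<in>sets P. emeasure P' A = emeasure P A)"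

definition natural_enlargement ::
  "'a measure \<Rightarrow> (real \<Rightarrow> 'a measure) \<Rightarrow> 'a measure \<Rightarrow> (real \<Rightarrow> 'a measure) \<Rightarrow> bool" where
  "natural_enlargement P FF P0 FF0 \<longleftrightarrow>
     extends_filtered_prob P FF P0 FF0 \<and> natural_conditions P FF \<and>
     (\<forall>P' FF'. extends_filtered_prob P' FF' P0 FF0 \<and> natural_conditions P' FF' \<longrightarrow>
        extends_filtered_prob P' FF' P FF)"

section \<open>Properties (P) and (NP)\<close>

definition countably_generated :: "'a measure \<Rightarrow> bool" where
  "countably_generated M \<longleftrightarrow>
     (\<exists>C. countable C \<and> C \<subseteq> Pow (space M) \<and> sets M = sigma_sets (space M) C)"

definition polish_topology :: "'b topology \<Rightarrow> bool" where
  "polish_topology T \<longleftrightarrow> completely_metrizable_space T \<and> separable_space T"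

definition borel_sets_of :: "'b topology \<Rightarrow> 'b set set" where
  "borel_sets_of T = sigma_sets (topspace T) {U. openin T U}"

(* The Polish space is a topology whose points form a set of elements of type 'a. This is no
   restriction: p maps onto it, so by choice a section of p transports any Polish space
   admitting such a surjection onto a subset of \<Omega>. *)
definition polish_quotient :: "'a measure \<Rightarrow> bool" where
  "polish_quotient G \<longleftrightarrow>
     (\<exists>(T :: 'a topology) p.
        polish_topology T \<and> p ` space G = topspace T \<and>
        sets G = {p -` B \<inter> space G | B. B \<in> borel_sets_of T} \<and>
        (\<forall>B\<in>sets G. \<forall>\<omega>\<in>space G. p \<omega> \<in> p ` B \<longrightarrow> \<omega> \<in> B))"

definition atom_at :: "'a measure \<Rightarrow> 'a \<Rightarrow> 'a set" where
  "atom_at G \<omega> = \<Inter>{B \<in> sets G. \<omega> \<in> B}"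

definition property_P :: "'a measure \<Rightarrow> (real \<Rightarrow> 'a measure) \<Rightarrow> bool" where
  "property_P M FF \<longleftrightarrow>
     filtered_space M FF \<and>
     sets M = sigma_sets (space M) (\<Union>t\<in>{0..}. sets (FF t)) \<and>
     (\<forall>t\<ge>0. countably_generated (FF t)) \<and>
     (\<forall>t\<ge>0. polish_quotient (FF t)) \<and>
     (\<forall>\<omega> :: nat \<Rightarrow> 'a.
        (\<forall>n. \<omega> n \<in> space M) \<and>
        (\<forall>N. (\<Inter>n\<in>{..N}. atom_at (FF (real n)) (\<omega> n)) \<noteq> {}) \<longrightarrow>
        (\<Inter>n. atom_at (FF (real n)) (\<omega> n)) \<noteq> {})"

definition property_NP :: "'a measure \<Rightarrow> (real \<Rightarrow> 'a measure) \<Rightarrow> bool" where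
  "property_NP P FF \<longleftrightarrow>
     (\<exists>P0 FF0. filtered_prob_space P0 FF0 \<and> property_P P0 FF0 \<and> natural_enlargement P FF P0 FF0)"

section \<open>Processes\<close>

definition adapted :: "(real \<Rightarrow> 'a measure) \<Rightarrow> (real \<Rightarrow> 'a \<Rightarrow> real) \<Rightarrow> bool" where
  "adapted FF X \<longleftrightarrow> (\<forall>t\<ge>0. X t \<in> borel_measurable (FF t))"

definition martingale :: "'a measure \<Rightarrow> (real \<Rightarrow> 'a measure) \<Rightarrow> (real \<Rightarrow> 'a \<Rightarrow> real) \<Rightarrow> bool" where
  "martingale P FF X \<longleftrightarrow>
     adapted FF X \<and> (\<forall>t\<ge>0. integrable P (X t)) \<and>
     (\<forall>s t. 0 \<le> s \<and> s \<le> t \<longrightarrow> (AE \<omega> in P. real_cond_exp P (FF s) (X t) \<omega> = X s \<omega>))"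

definition submartingale :: "'a measure \<Rightarrow> (real \<Rightarrow> 'a measure) \<Rightarrow> (real \<Rightarrow> 'a \<Rightarrow> real) \<Rightarrow> bool" where
  "submartingale P FF X \<longleftrightarrow>
     adapted FF X \<and> (\<forall>t\<ge>0. integrable P (X t)) \<and>
     (\<forall>s t. 0 \<le> s \<and> s \<le> t \<longrightarrow> (AE \<omega> in P. X s \<omega> \<le> real_cond_exp P (FF s) (X t) \<omega>))"

definition cadlag_path :: "(real \<Rightarrow> real) \<Rightarrow> bool" where
  "cadlag_path f \<longleftrightarrow>
     (\<forall>t\<ge>0. (f \<longlongrightarrow> f t) (at_right t)) \<and> (\<forall>t>0. \<exists>l. (f \<longlongrightarrow> l) (at_left t))"

definition cadlag_martingale ::
  "'a measure \<Rightarrow> (real \<Rightarrow> 'a measure) \<Rightarrow> (real \<Rightarrow> 'a \<Rightarrow> real) \<Rightarrow> bool" where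
  "cadlag_martingale P FF X \<longleftrightarrow>
     martingale P FF X \<and> (\<forall>\<omega>\<in>space P. cadlag_path (\<lambda>t. X t \<omega>))"

(* The Stieltjes measure da on [0,\<infinity>): extending a by the constant a 0 to negative times puts no
   mass on {..<0}, nor on {0} when a is continuous. *)
definition stieltjes_measure :: "(real \<Rightarrow> real) \<Rightarrow> real measure" where
  "stieltjes_measure a = interval_measure (\<lambda>t. a (max 0 t))"

(* X is a nonnegative submartingale of class (Sigma) with decomposition X = N + A. *)
definition class_Sigma ::
  "'a measure \<Rightarrow> (real \<Rightarrow> 'a measure) \<Rightarrow> (real \<Rightarrow> 'a \<Rightarrow> real) \<Rightarrow>
   (real \<Rightarrow> 'a \<Rightarrow> real) \<Rightarrow> (real \<Rightarrow> 'a \<Rightarrow> real) \<Rightarrow> bool" where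
  "class_Sigma P FF X N A \<longleftrightarrow>
     submartingale P FF X \<and> (\<forall>t\<ge>0. \<forall>\<omega>\<in>space P. 0 \<le> X t \<omega>) \<and>
     (\<forall>t\<ge>0. \<forall>\<omega>\<in>space P. X t \<omega> = N t \<omega> + A t \<omega>) \<and>
     cadlag_martingale P FF N \<and> adapted FF A \<and>
     (\<forall>\<omega>\<in>space P.
        continuous_on {0..} (\<lambda>t. A t \<omega>) \<and> mono_on {0..} (\<lambda>t. A t \<omega>) \<and> A 0 \<omega> = 0 \<and>
        (AE t in stieltjes_measure (\<lambda>t. A t \<omega>). t \<in> {t. 0 \<le> t \<and> X t \<omega> = 0}))"

definition terminal_value :: "(real \<Rightarrow> 'a \<Rightarrow> real) \<Rightarrow> 'a \<Rightarrow> ereal" where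
  "terminal_value A \<omega> = Lim at_top (\<lambda>t. ereal (A t \<omega>))"

section \<open>The measure Q and the martingales M(F)\<close>

(* In ennreal the supremum of the empty set is 0, as required for g. *)
definition last_zero :: "(real \<Rightarrow> 'a \<Rightarrow> real) \<Rightarrow> 'a \<Rightarrow> ennreal" where
  "last_zero X \<omega> = Sup (ennreal ` {t. 0 \<le> t \<and> X t \<omega> = 0})"

definition bounded_measurable :: "'a measure \<Rightarrow> ('a \<Rightarrow> real) \<Rightarrow> bool" where
  "bounded_measurable G f \<longleftrightarrow> f \<in> borel_measurable G \<and> bounded (f ` space G)"

(* has_bochner_integral states that the Q-integral is well defined as well as its value. *)
definition associated_measure ::
  "'a measure \<Rightarrow> (real \<Rightarrow> 'a measure) \<Rightarrow> (real \<Rightarrow> 'a \<Rightarrow> real) \<Rightarrow> 'a measure \<Rightarrow> bool" where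
  "associated_measure P FF X Q \<longleftrightarrow>
     sets Q = sets P \<and> sigma_finite_measure Q \<and>
     (AE \<omega> in Q. last_zero X \<omega> \<noteq> \<infinity>) \<and>
     (\<forall>t\<ge>0. \<forall>f. bounded_measurable (FF t) f \<longrightarrow>
        has_bochner_integral Q (\<lambda>\<omega>. f \<omega> * indicator {\<omega>. last_zero X \<omega> \<le> ennreal t} \<omega>)
          (\<integral>\<omega>. f \<omega> * X t \<omega> \<partial>P))"

(* M is a version of the martingale (M_t(F)); it is determined up to indistinguishability. *)
definition functional_martingale ::
  "'a measure \<Rightarrow> (real \<Rightarrow> 'a measure) \<Rightarrow> 'a measure \<Rightarrow> ('a \<Rightarrow> real) \<Rightarrow>
   (real \<Rightarrow> 'a \<Rightarrow> real) \<Rightarrow> bool" where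
  "functional_martingale P FF Q F M \<longleftrightarrow>
     cadlag_martingale P FF M \<and>
     (\<forall>t\<ge>0. \<forall>\<Gamma>. bounded_measurable (FF t) \<Gamma> \<longrightarrow>
        (\<integral>\<omega>. F \<omega> * \<Gamma> \<omega> \<partial>Q) = (\<integral>\<omega>. \<Gamma> \<omega> * M t \<omega> \<partial>P))"

end

(* The measure F.Q is finite and has density M t with respect to P on FF t, so that Doob's maximal
   inequality reads e * P(H and M exceeds e after time s) <= (F.Q)(H) for H in FF s. The measure dA
   being carried by the zeros of X, the last zero of X is infinite on {A_infinity = infinity}; hence
   this set is (F.Q)-null, and (F.Q)(A_infinity > n) tends to 0. Applying the inequality to
   H = {A s > n}, then letting s and n go to infinity, gives limsup M <= e almost surely on
   {A_infinity = infinity}. *)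

theory Submission
  imports Defs
begin

text \<open>A value above \<open>c\<close> at \<open>t\<close> would persist on an interval to the
  right of \<open>t\<close>, and this interval contains a rational beyond \<open>k\<close>. This
  carries estimates from rational times, where countability gives measurability and common null
  sets, to all real times.\<close>

lemma right_continuous_le_from_rationals:
  fixes f :: "real \<Rightarrow> real"
  assumes lim: "(f \<longlongrightarrow> f t) (at_right t)"
    and le: "\<And>q. q \<in> \<rat> \<Longrightarrow> k \<le> q \<Longrightarrow> f q \<le> c" and "k \<le> t"
  shows "f t \<le> c"
proof (rule ccontr)
  assume "\<not> f t \<le> c"
  then have "\<forall>\<^sub>F u in at_right t. c < f u" using order_tendstoD(1)[OF lim] by simp
  then obtain b where b: "b > t" "\<And>u. t < u \<Longrightarrow> u < b \<Longrightarrow> c < f u"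
    unfolding eventually_at_right_field by auto
  obtain q where "q \<in> \<rat>" "t < q" "q < b" using Rats_dense_in_real[OF b(1)] by auto
  then show False using b(2)[of q] le[of q] assms(3) by force
qed

section \<open>Density processes of finite measures\<close>

text \<open>Here \<open>M t\<close> is a density, on \<open>FF t\<close>, of the finite measure
  \<open>F\<close>.\<open>Q\<close> with respect to \<open>P\<close>. All these densities come from
  one measure, and comparing with it takes the place of optional stopping below.\<close>

locale density_process = filtered_prob_space P FF
  for P :: "'a measure" and FF :: "real \<Rightarrow> 'a measure" +
  fixes Q :: "'a measure" and F :: "'a \<Rightarrow> real" and M :: "real \<Rightarrow> 'a \<Rightarrow> real"
  assumes sets_Q: "sets Q = sets P"
    and F_nonneg: "\<And>\<omega>. \<omega> \<in> space P \<Longrightarrow> 0 \<le> F \<omega>"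
    and F_integrable: "integrable Q F"
    and M_adapted: "adapted FF M"
    and M_integrable: "\<And>t. 0 \<le> t \<Longrightarrow> integrable P (M t)"
    and density: "\<And>t C. 0 \<le> t \<Longrightarrow> C \<in> sets (FF t) \<Longrightarrow>
      (\<integral>\<omega>. F \<omega> * indicator C \<omega> \<partial>Q) = (\<integral>\<omega>. indicator C \<omega> * M t \<omega> \<partial>P)"
begin

lemma space_FF: "0 \<le> t \<Longrightarrow> space (FF t) = space P"
  and sets_FF: "0 \<le> t \<Longrightarrow> C \<in> sets (FF t) \<Longrightarrow> C \<in> sets P"
  using subalgebra_FF[of t] by (auto simp: subalgebra_def)

lemma space_Q: "space Q = space P"
  using sets_Q by (rule sets_eq_imp_space_eq)

lemma superlevel_sets_FF:
  assumes "adapted FF Y" "0 \<le> t"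
  shows "{\<omega> \<in> space P. Y t \<omega> > c} \<in> sets (FF t)"
proof -
  have "Y t \<in> borel_measurable (FF t)" using assms by (simp add: adapted_def)
  then show ?thesis
    using assms(2) by (simp only: borel_measurable_iff_greater space_FF)
qed

lemma integrable_F_indicator: "C \<in> sets P \<Longrightarrow> integrable Q (\<lambda>\<omega>. F \<omega> * indicator C \<omega>)"
  using F_integrable sets_Q by (intro integrable_real_mult_indicator) auto

lemma integral_F_mono:
  assumes "C \<in> sets P" "D \<in> sets P" "C \<subseteq> D"
  shows "(\<integral>\<omega>. F \<omega> * indicator C \<omega> \<partial>Q) \<le> (\<integral>\<omega>. F \<omega> * indicator D \<omega> \<partial>Q)"
  using assms F_nonneg
  by (intro integral_mono integrable_F_indicator) (auto simp: space_Q indicator_def)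

text \<open>The set where \<open>M t\<close> is negative belongs to \<open>FF t\<close>, so
  \<open>density\<close> equates the integral of \<open>M t\<close> over it with an integral of
  \<open>F\<close>. The first is at most zero, the second at least zero, hence the set is
  null.\<close>

lemma M_nonneg:
  assumes "0 \<le> t"
  shows "AE \<omega> in P. 0 \<le> M t \<omega>"
proof -
  let ?C = "{\<omega> \<in> space P. M t \<omega> < 0}"
  have C: "?C \<in> sets (FF t)"
    using M_adapted borel_measurable_iff_less[of "M t" "FF t"] space_FF[of t] assms
    by (auto simp: adapted_def)
  note CP = sets_FF[OF assms C]
  have int: "integrable P (\<lambda>\<omega>. - (indicator ?C \<omega> * M t \<omega>))"
    using integrable_real_mult_indicator[OF CP M_integrable[OF assms]] by (simp add: mult.commute)
  have nn: "AE \<omega> in P. 0 \<le> - (indicator ?C \<omega> * M t \<omega>)"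
    by (auto simp: indicator_def)
  have "0 \<le> (\<integral>\<omega>. F \<omega> * indicator ?C \<omega> \<partial>Q)"
    using F_nonneg by (intro integral_nonneg_AE AE_I2) (auto simp: space_Q)
  then have "(\<integral>\<omega>. - (indicator ?C \<omega> * M t \<omega>) \<partial>P) \<le> 0"
    using density[OF assms C] by simp
  moreover have "(\<integral>\<omega>. - (indicator ?C \<omega> * M t \<omega>) \<partial>P) \<ge> 0"
    using nn by (rule integral_nonneg_AE)
  ultimately have "AE \<omega> in P. - (indicator ?C \<omega> * M t \<omega>) = 0"
    using integral_nonneg_eq_0_iff_AE[OF int nn] by simp
  then show ?thesis
    by (rule AE_mp) (auto simp: indicator_def)
qed

section \<open>Doob's maximal inequality for the density process\<close>

text \<open>The event is split according to the first time \<open>t\<close> in \<open>T\<close> at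
  which \<open>M\<close> exceeds \<open>e\<close>. Each piece lies in \<open>FF t\<close>, so its
  probability can be compared with its mass under \<open>F\<close>.\<open>Q\<close>; the pieces are
  disjoint subsets of \<open>H\<close>, so these masses add up to at most that of
  \<open>H\<close>.\<close>

lemma maximal_inequality_finite:
  assumes "0 \<le> s" "H \<in> sets (FF s)" "finite T" "T \<subseteq> {s..}"
  shows "e * prob {\<omega> \<in> H. \<exists>t\<in>T. M t \<omega> > e} \<le> (\<integral>\<omega>. F \<omega> * indicator H \<omega> \<partial>Q)"
proof -
  \<comment> \<open>\<open>C t\<close> is the part of \<open>H\<close> on which \<open>t\<close> is
    the first exceedance time in \<open>T\<close>. It depends only on times up to
    \<open>t\<close>.\<close>
  define C where
    "C t = (H \<inter> {\<omega> \<in> space P. M t \<omega> > e}) - (\<Union>u\<in>{u\<in>T. u < t}. {\<omega> \<in> space P. M u \<omega> > e})" for t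
  have Ct: "C t \<in> sets (FF t)" if "t \<in> T" for t
  proof -
    have t: "0 \<le> s" "s \<le> t" using assms that by auto
    have "{\<omega> \<in> space P. M u \<omega> > e} \<in> sets (FF t)" if "u \<in> T" "u \<le> t" for u
    proof -
      have "0 \<le> u" using assms that by auto
      then show ?thesis
        using superlevel_sets_FF[OF M_adapted, of u e] FF_mono[of u t] that by blast
    qed
    moreover have "H \<in> sets (FF t)"
      using FF_mono[OF t] assms(2) by blast
    ultimately show ?thesis
      using assms that unfolding C_def by (intro sets.Diff sets.Int sets.finite_UN) auto
  qed
  have pos: "0 \<le> t" if "t \<in> T" for t using assms that by auto
  have CP: "C t \<in> sets P" if "t \<in> T" for t using sets_FF[OF pos Ct] that by simp
  have HP: "H \<in> sets P" using sets_FF assms by simp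
  have Hspace: "H \<subseteq> space P" using HP by (rule sets.sets_into_space)
  have disj: "disjoint_family_on C T"
  proof -
    have "C m \<inter> C n = {}" if "m \<in> T" "m < n" for m n
      using that by (auto simp: C_def)
    then show ?thesis
      unfolding disjoint_family_on_def by (metis Int_commute linorder_neqE_linordered_idom)
  qed
  have un: "{\<omega> \<in> H. \<exists>t\<in>T. M t \<omega> > e} = (\<Union>t\<in>T. C t)" (is "?L = ?R")
  proof
    show "?R \<subseteq> ?L" by (auto simp: C_def)
    show "?L \<subseteq> ?R"
    proof
      fix \<omega> assume w: "\<omega> \<in> ?L"
      let ?S = "{t\<in>T. M t \<omega> > e}"
      have S: "finite ?S" "?S \<noteq> {}" using assms w by auto
      have "Min ?S \<in> ?S" using S by (rule Min_in)
      moreover have "\<not> M u \<omega> > e" if "u \<in> T" "u < Min ?S" for u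
        using Min_le[OF S(1), of u] that by auto
      ultimately have "\<omega> \<in> C (Min ?S)" using w Hspace by (auto simp: C_def)
      then show "\<omega> \<in> ?R" using \<open>Min ?S \<in> ?S\<close> by blast
    qed
  qed
  \<comment> \<open>On \<open>C t\<close> the value \<open>M t\<close> is above \<open>e\<close>,
    and \<open>density\<close> turns the integral of \<open>M t\<close> over \<open>C t\<close> into
    one of \<open>F\<close> under \<open>Q\<close>.\<close>
  have piece: "e * prob (C t) \<le> (\<integral>\<omega>. F \<omega> * indicator (C t) \<omega> \<partial>Q)" if "t \<in> T" for t
  proof -
    have "e * prob (C t) = (\<integral>\<omega>. e * indicator (C t) \<omega> \<partial>P)"
      using CP[OF that] by simp
    also have "\<dots> \<le> (\<integral>\<omega>. indicator (C t) \<omega> * M t \<omega> \<partial>P)"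
    proof (rule integral_mono)
      show "integrable P (\<lambda>\<omega>. e * indicator (C t) \<omega>)"
        using CP[OF that] by (intro integrable_mult_right integrable_real_indicator)
          (auto simp: emeasure_eq_measure)
      show "integrable P (\<lambda>\<omega>. indicator (C t) \<omega> * M t \<omega>)"
        using integrable_real_mult_indicator[OF CP[OF that] M_integrable[OF pos[OF that]]]
        by (simp add: mult.commute)
    qed (auto simp: indicator_def C_def)
    finally show ?thesis using density[OF pos Ct] that by simp
  qed
  have "e * prob {\<omega> \<in> H. \<exists>t\<in>T. M t \<omega> > e} = (\<Sum>t\<in>T. e * prob (C t))"
    unfolding un sum_distrib_left[symmetric]
    using assms(3) disj CP by (subst finite_measure_finite_Union) auto
  also have "\<dots> \<le> (\<Sum>t\<in>T. \<integral>\<omega>. F \<omega> * indicator (C t) \<omega> \<partial>Q)"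
    by (intro sum_mono piece)
  also have "\<dots> = (\<integral>\<omega>. (\<Sum>t\<in>T. F \<omega> * indicator (C t) \<omega>) \<partial>Q)"
    using CP by (intro Bochner_Integration.integral_sum[symmetric] integrable_F_indicator) auto
  also have "\<dots> = (\<integral>\<omega>. F \<omega> * indicator (\<Union>t\<in>T. C t) \<omega> \<partial>Q)"
    using disj assms(3) by (simp add: sum_distrib_left[symmetric] indicator_UN_disjoint)
  also have "\<dots> \<le> (\<integral>\<omega>. F \<omega> * indicator H \<omega> \<partial>Q)"
    using CP HP assms(3) by (intro integral_F_mono) (auto simp: C_def)
  finally show ?thesis .
qed

lemma exceed_sets:
  assumes "H \<in> sets P" "countable T" "T \<subseteq> {0..}"
  shows "{\<omega> \<in> H. \<exists>t\<in>T. M t \<omega> > e} \<in> sets P"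
proof -
  have "{\<omega> \<in> H. \<exists>t\<in>T. M t \<omega> > e} = H \<inter> (\<Union>t\<in>T. {\<omega> \<in> space P. M t \<omega> > e})"
    using sets.sets_into_space[OF assms(1)] by auto
  also have "\<dots> \<in> sets P"
  proof (intro sets.Int sets.countable_UN'' assms(1,2))
    fix t assume "t \<in> T"
    then have "0 \<le> t" using assms(3) by auto
    then show "{\<omega> \<in> space P. M t \<omega> > e} \<in> sets P"
      by (intro sets_FF[of t] superlevel_sets_FF[OF M_adapted])
  qed
  finally show ?thesis .
qed

text \<open>The bound for finite sets of times does not depend on the set, so continuity of
  \<open>P\<close> from below extends it to an increasing union of finite sets.\<close>

lemma maximal_inequality_countable:
  assumes "0 \<le> s" "H \<in> sets (FF s)" "countable T" "T \<subseteq> {s..}" "0 < e"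
  shows "e * prob {\<omega> \<in> H. \<exists>t\<in>T. M t \<omega> > e} \<le> (\<integral>\<omega>. F \<omega> * indicator H \<omega> \<partial>Q)"
\<comment> \<open>\<open>from_nat_into\<close> enumerates \<open>T\<close> only if \<open>T\<close>
  is nonempty.\<close>
proof (cases "T = {}")
  case True
  then show ?thesis by (intro maximal_inequality_finite[OF assms(1,2)]) auto
next
  case False
  define T' where "T' n = from_nat_into T ` {..n}" for n :: nat
  have T: "T = (\<Union>n. T' n)"
  proof -
    have "(\<Union>n. T' n) = range (from_nat_into T)" unfolding T'_def by blast
    then show ?thesis using range_from_nat_into[OF False assms(3)] by simp
  qed
  have T'_sub: "T' n \<subseteq> {s..}" for n using T assms(4) by blast
  have T'_fin: "finite (T' n)" for n by (simp add: T'_def)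
  have T'mono: "mono T'" by (auto simp: mono_def T'_def)
  have HP: "H \<in> sets P" using sets_FF assms by simp
  let ?B = "\<lambda>n. {\<omega> \<in> H. \<exists>t\<in>T' n. M t \<omega> > e}"
  have "?B n \<in> sets P" for n
  proof (rule exceed_sets[OF HP])
    show "T' n \<subseteq> {0..}" using T'_sub[of n] assms(1) by fastforce
  qed (simp add: T'_fin countable_finite)
  moreover have "incseq ?B"
    using T'mono unfolding mono_def by blast
  ultimately have "(\<lambda>n. prob (?B n)) \<longlonglongrightarrow> prob (\<Union>n. ?B n)"
    by (intro finite_Lim_measure_incseq) auto
  moreover have "(\<Union>n. ?B n) = {\<omega> \<in> H. \<exists>t\<in>T. M t \<omega> > e}" using T by blast
  ultimately have "(\<lambda>n. e * prob (?B n)) \<longlonglongrightarrow> e * prob {\<omega> \<in> H. \<exists>t\<in>T. M t \<omega> > e}"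
    by (simp only: tendsto_mult_left)
  moreover have "e * prob (?B n) \<le> (\<integral>\<omega>. F \<omega> * indicator H \<omega> \<partial>Q)" for n
    by (rule maximal_inequality_finite[OF assms(1,2) T'_fin T'_sub])
  ultimately show ?thesis by (intro LIMSEQ_le_const2) auto
qed

section \<open>Convergence where the increasing process is unbounded\<close>

lemma AE_eventually_le:
  fixes A :: "real \<Rightarrow> 'a \<Rightarrow> real"
  assumes "adapted FF A"
    and mono: "\<And>\<omega>. \<omega> \<in> space P \<Longrightarrow> mono_on {0..} (\<lambda>t. A t \<omega>)"
    and null: "AE \<omega> in Q. \<exists>c. \<forall>t\<ge>0. A t \<omega> \<le> c"
    and "0 < e"
  shows "AE \<omega> in P. (\<forall>c. \<exists>t\<ge>0. A t \<omega> > c) \<longrightarrow> (\<exists>k::nat. \<forall>t\<in>\<rat> \<inter> {real k..}. M t \<omega> \<le> e)"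
proof -
  \<comment> \<open>\<open>H n k\<close> is known at time \<open>k\<close>, so the maximal
    inequality applies to it from \<open>k\<close> on. As \<open>A\<close> increases, these sets
    grow with \<open>k\<close>, and their union is the set where \<open>A\<close> exceeds
    \<open>n\<close> at some time.\<close>
  define H where "H n k = {\<omega> \<in> space P. A (real k) \<omega> > real n}" for n k :: nat
  \<comment> \<open>On \<open>B\<close>, \<open>M\<close> exceeds \<open>e\<close> at arbitrarily
    late rational times. \<open>J n\<close> is the mass under \<open>F\<close>.\<open>Q\<close> of
    the union of the \<open>H n k\<close>.\<close>
  define B where "B = (\<Inter>j::nat. {\<omega> \<in> space P. \<exists>t\<in>\<rat> \<inter> {real j..}. M t \<omega> > e})"
  define J where "J n = (\<integral>\<omega>. F \<omega> * indicator (\<Union>k. H n k) \<omega> \<partial>Q)" for n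
  have HF: "H n k \<in> sets (FF (real k))" for n k
    unfolding H_def by (intro superlevel_sets_FF assms(1)) simp
  have HP: "H n k \<in> sets P" for n k by (rule sets_FF[OF _ HF]) simp
  have rat: "countable (\<rat> \<inter> {real j..})" for j :: nat
    using countable_rat by blast
  have BP: "B \<in> sets P"
    unfolding B_def by (rule sets.countable_INT') (auto intro!: exceed_sets rat)
  have H_incseq: "incseq (H n)" for n
  proof -
    have "A (real k) \<omega> \<le> A (real l) \<omega>" if "k \<le> l" "\<omega> \<in> space P" for k l :: nat and \<omega>
      using mono_onD[OF mono[OF that(2)], of "real k" "real l"] that(1) by simp
    then show ?thesis
      unfolding incseq_def H_def by (fast dest: less_le_trans)
  qed
  have HBP: "(\<Union>k. H n k) \<inter> B \<in> sets P" for n using HP BP by auto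
  have bound: "e * prob ((\<Union>k. H n k) \<inter> B) \<le> J n" for n
  proof -
    have "incseq (\<lambda>k. H n k \<inter> B)"
      using H_incseq[of n] unfolding incseq_def by blast
    then have "(\<lambda>k. prob (H n k \<inter> B)) \<longlonglongrightarrow> prob (\<Union>k. H n k \<inter> B)"
      using HP BP by (intro finite_Lim_measure_incseq) auto
    then have "(\<lambda>k. e * prob (H n k \<inter> B)) \<longlonglongrightarrow> e * prob ((\<Union>k. H n k) \<inter> B)"
      by (intro tendsto_mult_left) simp
    moreover have "e * prob (H n k \<inter> B) \<le> J n" for k
    proof -
      \<comment> \<open>Whatever \<open>k\<close> is, a point of \<open>B\<close> has an exceedance
        after time \<open>k\<close>; the resulting bound \<open>J n\<close> is uniform in
        \<open>k\<close>.\<close>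
      have "e * prob (H n k \<inter> B) \<le> e * prob {\<omega> \<in> H n k. \<exists>t\<in>\<rat> \<inter> {real k..}. M t \<omega> > e}"
      proof (intro mult_left_mono finite_measure_mono exceed_sets rat HP)
        show "H n k \<inter> B \<subseteq> {\<omega> \<in> H n k. \<exists>t\<in>\<rat> \<inter> {real k..}. M t \<omega> > e}"
          unfolding B_def by blast
      qed (use assms(4) in auto)
      also have "\<dots> \<le> (\<integral>\<omega>. F \<omega> * indicator (H n k) \<omega> \<partial>Q)"
        by (intro maximal_inequality_countable[of "real k"] HF rat assms(4)) auto
      also have "\<dots> \<le> J n"
        unfolding J_def by (intro integral_F_mono HP sets.countable_UN) (auto simp: HP)
      finally show ?thesis .
    qed
    ultimately show ?thesis by (intro LIMSEQ_le_const2) auto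
  qed
  \<comment> \<open>For \<open>Q\<close>-almost every point \<open>A\<close> is bounded, so the
    indicators vanish once \<open>n\<close> passes the bound; \<open>F\<close> dominates.\<close>
  have J0: "J \<longlonglongrightarrow> 0"
  proof -
    have "J \<longlonglongrightarrow> (\<integral>\<omega>. 0 \<partial>Q)"
      unfolding J_def
    proof (rule integral_dominated_convergence[where w = F])
      show "AE \<omega> in Q. (\<lambda>n. F \<omega> * indicator (\<Union>k. H n k) \<omega>) \<longlonglongrightarrow> 0"
        using null
      proof eventually_elim
        case (elim \<omega>)
        then obtain c where c: "\<And>t. t \<ge> 0 \<Longrightarrow> A t \<omega> \<le> c" by auto
        obtain m :: nat where m: "c \<le> real m" using real_arch_simple by blast
        have "\<omega> \<notin> (\<Union>k. H n k)" if "n \<ge> m" for n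
        proof
          assume "\<omega> \<in> (\<Union>k. H n k)"
          then obtain k where "A (real k) \<omega> > real n" by (auto simp: H_def)
          then show False using c[of "real k"] m that by auto
        qed
        then have "\<forall>\<^sub>F n in sequentially. F \<omega> * indicator (\<Union>k. H n k) \<omega> = 0"
          unfolding eventually_sequentially by (intro exI[of _ m]) (simp del: UN_iff)
        then show ?case by (rule tendsto_eventually)
      qed
      show "(\<lambda>\<omega>. F \<omega> * indicator (\<Union>k. H n k) \<omega>) \<in> borel_measurable Q" for n
        using integrable_F_indicator[of "\<Union>k. H n k"] HP by auto
      show "AE \<omega> in Q. norm (F \<omega> * indicator (\<Union>k. H n k) \<omega>) \<le> F \<omega>" for n
        using F_nonneg by (intro AE_I2) (auto simp: space_Q indicator_def)
    qed (use F_integrable in auto)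
    then show ?thesis by simp
  qed
  \<comment> \<open>This is the part of \<open>B\<close> where \<open>A\<close> is unbounded: its
    probability times \<open>e\<close> is at most every \<open>J n\<close>, hence zero.\<close>
  let ?N = "\<Inter>n. (\<Union>k. H n k) \<inter> B"
  have NP: "?N \<in> sets P" by (rule sets.countable_INT) (use HBP in blast)+
  have "e * prob ?N \<le> J n" for n
    using bound[of n] HBP[of n] assms(4)
    by (meson INF_lower UNIV_I finite_measure_mono less_imp_le mult_left_mono order_trans)
  then have "e * prob ?N \<le> 0"
    using J0 by (intro LIMSEQ_le_const) auto
  then have "prob ?N \<le> 0"
    using assms(4) by (simp add: mult_le_0_iff)
  then have "prob ?N = 0" by (intro antisym measure_nonneg)
  then have "AE \<omega> in P. \<omega> \<notin> ?N"
    using NP by (intro AE_not_in) (simp add: null_sets_def emeasure_eq_measure)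
  then show ?thesis
  proof (rule AE_mp, intro AE_I2 impI)
    fix \<omega> assume w: "\<omega> \<in> space P" "\<omega> \<notin> ?N" and inf: "\<forall>c. \<exists>t\<ge>0. A t \<omega> > c"
    have "\<exists>k. \<omega> \<in> H n k" for n
    proof -
      obtain t where t: "t \<ge> 0" "A t \<omega> > real n" using inf by auto
      obtain k :: nat where k: "t \<le> real k" using real_arch_simple by blast
      have "A t \<omega> \<le> A (real k) \<omega>"
        using mono[OF w(1)] t k by (auto simp: mono_on_def)
      then show ?thesis using t w by (auto simp: H_def intro!: exI[of _ k])
    qed
    then have "\<omega> \<notin> B" using w by auto
    then show "\<exists>k::nat. \<forall>t\<in>\<rat> \<inter> {real k..}. M t \<omega> \<le> e"
      using w by (auto simp: B_def not_less)
  qed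
qed

text \<open>The levels 1/(m+1) and the rational times are countable, so one null set serves all
  upper bounds and the nonnegativity at rational times. Right continuity then gives both bounds at
  every late real time.\<close>

lemma tendsto_zero_of_bounded:
  fixes A :: "real \<Rightarrow> 'a \<Rightarrow> real"
  assumes "adapted FF A"
    and "\<And>\<omega>. \<omega> \<in> space P \<Longrightarrow> mono_on {0..} (\<lambda>t. A t \<omega>)"
    and "AE \<omega> in Q. \<exists>c. \<forall>t\<ge>0. A t \<omega> \<le> c"
    and right_cont: "\<And>\<omega> t. \<omega> \<in> space P \<Longrightarrow> 0 \<le> t \<Longrightarrow> ((\<lambda>t. M t \<omega>) \<longlongrightarrow> M t \<omega>) (at_right t)"
  shows "AE \<omega> in P. (\<forall>c. \<exists>t\<ge>0. A t \<omega> > c) \<longrightarrow> ((\<lambda>t. M t \<omega>) \<longlongrightarrow> 0) at_top"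
proof -
  have "AE \<omega> in P. \<forall>m::nat. (\<forall>c. \<exists>t\<ge>0. A t \<omega> > c) \<longrightarrow>
      (\<exists>k::nat. \<forall>t\<in>\<rat> \<inter> {real k..}. M t \<omega> \<le> inverse (real (Suc m)))"
    unfolding AE_all_countable by (intro allI AE_eventually_le assms) auto
  moreover have "AE \<omega> in P. \<forall>t\<in>\<rat> \<inter> {0..}. 0 \<le> M t \<omega>"
    using countable_rat M_nonneg by (subst AE_ball_countable) auto
  moreover note AE_space
  ultimately show ?thesis
  proof eventually_elim
    case (elim \<omega>)
    show ?case
    proof
      assume inf: "\<forall>c. \<exists>t\<ge>0. A t \<omega> > c"
      show "((\<lambda>t. M t \<omega>) \<longlongrightarrow> 0) at_top"
      proof (rule tendstoI)
        fix e :: real assume "0 < e"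
        then obtain m :: nat where m: "inverse (real (Suc m)) < e" using reals_Archimedean by blast
        obtain k :: nat where k: "\<forall>t\<in>\<rat> \<inter> {real k..}. M t \<omega> \<le> inverse (real (Suc m))"
          using elim(1) inf by blast
        have "dist (M t \<omega>) 0 < e" if "t \<ge> real k" for t
        proof -
          have rc: "((\<lambda>t. M t \<omega>) \<longlongrightarrow> M t \<omega>) (at_right t)"
            using right_cont[OF elim(3), of t] that by simp
          have "M t \<omega> \<le> inverse (real (Suc m))"
            using k by (intro right_continuous_le_from_rationals[OF rc _ that]) auto
          \<comment> \<open>Nonnegativity is almost sure for each fixed time, so it also passes
            through the rationals, this time for the negated path.\<close>
          moreover have "- M t \<omega> \<le> 0"
            using elim(2) that
            by (intro right_continuous_le_from_rationals[OF tendsto_minus[OF rc], of 0]) auto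
          ultimately show ?thesis using m by (simp add: dist_real_def)
        qed
        then show "\<forall>\<^sub>F t in at_top. dist (M t \<omega>) 0 < e"
          unfolding eventually_at_top_linorder by blast
      qed
    qed
  qed
qed

end

section \<open>The last zero of X\<close>

text \<open>\<open>Lim\<close> is a description operator, so its value \<infinity> alone yields no
  convergence. Instead, a bounded increasing path converges to its real supremum, and uniqueness of
  limits makes the terminal value finite.\<close>

lemma unbounded_of_terminal_value_infinite:
  assumes "mono_on {0..} (\<lambda>t. A t \<omega>)" "terminal_value A \<omega> = \<infinity>"
  shows "\<exists>t\<ge>0. A t \<omega> > c"
proof (rule ccontr)
  assume "\<not> ?thesis"
  then have le: "A t \<omega> \<le> c" if "t \<ge> 0" for t using that by (auto simp: not_less)
  define S where "S = Sup ((\<lambda>t. A t \<omega>) ` {0..})"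
  have bdd: "bdd_above ((\<lambda>t. A t \<omega>) ` {0..})" using le by (auto intro!: bdd_aboveI)
  have "((\<lambda>t. A t \<omega>) \<longlongrightarrow> S) at_top"
  proof (rule order_tendstoI)
    fix a assume "a < S"
    then obtain u where u: "u \<ge> 0" "a < A u \<omega>"
      using less_cSup_iff[OF _ bdd] by (auto simp: S_def)
    have "a < A t \<omega>" if "t \<ge> u" for t
      using u that mono_onD[OF assms(1), of u t] by auto
    then show "\<forall>\<^sub>F t in at_top. a < A t \<omega>"
      unfolding eventually_at_top_linorder by blast
  next
    fix a assume "S < a"
    have "A t \<omega> < a" if "t \<ge> 0" for t
      using cSup_upper[OF _ bdd, of "A t \<omega>"] that \<open>S < a\<close> unfolding S_def by auto
    then show "\<forall>\<^sub>F t in at_top. A t \<omega> < a"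
      unfolding eventually_at_top_linorder by blast
  qed
  then have "((\<lambda>t. ereal (A t \<omega>)) \<longlongrightarrow> ereal S) at_top" by (rule tendsto_ereal)
  then have "terminal_value A \<omega> = ereal S"
    unfolding terminal_value_def by (intro tendsto_Lim) auto
  then show False using assms(2) by simp
qed

text \<open>For \<open>b\<close> beyond \<open>K\<close>, the interval from \<open>K\<close> to
  \<open>b\<close> has Stieltjes mass \<open>a b - a K\<close>, and it is null when the measure is
  carried by times up to \<open>K\<close>.\<close>

lemma bounded_of_stieltjes_carried:
  fixes a :: "real \<Rightarrow> real"
  assumes cont: "continuous_on {0..} a" and mono: "mono_on {0..} a"
    and carried: "AE t in stieltjes_measure a. t \<le> K" and "0 \<le> K" "0 \<le> b"
  shows "a b \<le> a K"
proof (cases "b \<le> K")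
  case True
  then show ?thesis using mono_onD[OF mono] assms by auto
next
  case False
  \<comment> \<open>The constant extension makes \<open>a\<close> monotone and continuous on the
    whole line, as the mass formula for intervals requires.\<close>
  let ?a = "\<lambda>t. a (max 0 t)"
  have c: "continuous_on UNIV ?a"
    by (intro continuous_on_compose2[OF cont] continuous_intros) auto
  have em: "emeasure (stieltjes_measure a) {K<..b} = ennreal (?a b - ?a K)"
    unfolding stieltjes_measure_def
  proof (rule emeasure_interval_measure_Ioc)
    show "?a x \<le> ?a y" if "x \<le> y" for x y
      using that by (intro mono_onD[OF mono]) auto
    show "continuous (at_right x) ?a" for x
      using c by (meson UNIV_I continuous_at_imp_continuous_at_within continuous_on_eq_continuous_at
          open_UNIV)
  qed (use False in auto)
  have "{K<..b} \<in> null_sets (stieltjes_measure a)"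
  proof (subst AE_iff_null_sets)
    show "{K<..b} \<in> sets (stieltjes_measure a)" by (simp add: stieltjes_measure_def)
    show "AE t in stieltjes_measure a. t \<notin> {K<..b}" using carried by eventually_elim auto
  qed
  then have "emeasure (stieltjes_measure a) {K<..b} = 0" by auto
  \<comment> \<open>\<open>ennreal\<close> truncates negative numbers to zero, so zero mass says
    exactly that \<open>a b - a K\<close> is at most zero.\<close>
  then show ?thesis using em assms by (simp add: ennreal_eq_0_iff)
qed

text \<open>Every zero of \<open>X\<close> lies before the last one, and \<open>dA\<close> is
  carried by the zeros; so \<open>A\<close> stops increasing after a finite last zero.\<close>

lemma class_Sigma_bounded:
  assumes "class_Sigma P FF X N A" "\<omega> \<in> space P" "last_zero X \<omega> \<noteq> \<infinity>"
  shows "\<exists>c. \<forall>t\<ge>0. A t \<omega> \<le> c"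
proof -
  \<comment> \<open>The last zero as a real number; without zeros it is 0, which still serves as
    \<open>K\<close>.\<close>
  define K where "K = enn2real (last_zero X \<omega>)"
  have K: "ennreal K = last_zero X \<omega>" "0 \<le> K"
    using assms(3) by (auto simp: K_def less_top)
  have zero_le: "t \<le> K" if "0 \<le> t" "X t \<omega> = 0" for t
  proof -
    have "ennreal t \<le> ennreal K"
      unfolding K last_zero_def using that by (intro Sup_upper) auto
    then show ?thesis using K(2) by (simp add: ennreal_le_iff)
  qed
  have S: "continuous_on {0..} (\<lambda>t. A t \<omega>)" "mono_on {0..} (\<lambda>t. A t \<omega>)"
      "AE t in stieltjes_measure (\<lambda>t. A t \<omega>). t \<in> {t. 0 \<le> t \<and> X t \<omega> = 0}"
    using assms(1,2) by (auto simp: class_Sigma_def)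
  have "AE t in stieltjes_measure (\<lambda>t. A t \<omega>). t \<le> K"
    using S(3) by eventually_elim (auto intro: zero_le)
  then have "A t \<omega> \<le> A K \<omega>" if "t \<ge> 0" for t
    using bounded_of_stieltjes_carried[OF S(1,2)] K(2) that by blast
  then show ?thesis by blast
qed

section \<open>Convergence of the martingale associated with \<open>F\<close>\<close>

theorem proposition3p1:
  fixes P Q :: "'a measure" and FF :: "real \<Rightarrow> 'a measure"
    and X N A M :: "real \<Rightarrow> 'a \<Rightarrow> real" and F :: "'a \<Rightarrow> real"
  assumes "filtered_prob_space P FF"
    and "property_NP P FF"
    and "class_Sigma P FF X N A"
    and "associated_measure P FF X Q"
    and "\<And>\<omega>. \<omega> \<in> space P \<Longrightarrow> 0 \<le> F \<omega>"
    and "integrable Q F"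
    and "functional_martingale P FF Q F M"
  shows "AE \<omega> in P. terminal_value A \<omega> = \<infinity> \<longrightarrow> ((\<lambda>t. M t \<omega>) \<longlongrightarrow> 0) at_top"
proof -
  interpret filtered_prob_space P FF by fact
  have sets_Q: "sets Q = sets P" and g: "AE \<omega> in Q. last_zero X \<omega> \<noteq> \<infinity>"
    using assms(4) by (auto simp: associated_measure_def)
  have M: "cadlag_martingale P FF M"
    and dens: "\<And>t \<Gamma>. 0 \<le> t \<Longrightarrow> bounded_measurable (FF t) \<Gamma> \<Longrightarrow>
      (\<integral>\<omega>. F \<omega> * \<Gamma> \<omega> \<partial>Q) = (\<integral>\<omega>. \<Gamma> \<omega> * M t \<omega> \<partial>P)"
    using assms(7) by (auto simp: functional_martingale_def)
  have A: "adapted FF A" "\<And>\<omega>. \<omega> \<in> space P \<Longrightarrow> mono_on {0..} (\<lambda>t. A t \<omega>)"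
    using assms(3) by (auto simp: class_Sigma_def)
  interpret density_process P FF Q F M
  proof
    show "adapted FF M"
      using M by (simp add: cadlag_martingale_def martingale_def)
    show "integrable P (M t)" if "0 \<le> t" for t
      using M that by (simp_all add: cadlag_martingale_def martingale_def)
    show "(\<integral>\<omega>. F \<omega> * indicator C \<omega> \<partial>Q) = (\<integral>\<omega>. indicator C \<omega> * M t \<omega> \<partial>P)"
      if "0 \<le> t" "C \<in> sets (FF t)" for t C
    proof (rule dens[OF that(1)])
      \<comment> \<open>Indicators are bounded, hence admissible test functions in the identity
        defining the martingale.\<close>
      have "range (indicator C :: 'a \<Rightarrow> real) \<subseteq> {0, 1}" by (auto simp: indicator_def)
      then have "bounded ((indicator C :: 'a \<Rightarrow> real) ` space (FF t))"
        by (meson bounded_subset finite.intros finite_imp_bounded image_mono subset_UNIV)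
      then show "bounded_measurable (FF t) (indicator C)"
        using that(2) by (simp add: bounded_measurable_def)
    qed
  qed (use assms(5,6) sets_Q in simp_all)
  \<comment> \<open>The condition that \<open>Q\<close> gives no mass to an infinite last zero
    enters here: it bounds \<open>A\<close> almost everywhere under \<open>Q\<close>, while the
    conclusion concerns \<open>P\<close>.\<close>
  have bdd: "AE \<omega> in Q. \<exists>c. \<forall>t\<ge>0. A t \<omega> \<le> c"
    using g AE_space
    by eventually_elim (rule class_Sigma_bounded[OF assms(3)], simp_all add: space_Q)
  have right_cont: "((\<lambda>t. M t \<omega>) \<longlongrightarrow> M t \<omega>) (at_right t)" if "\<omega> \<in> space P" "0 \<le> t" for \<omega> t
    using M that by (simp add: cadlag_martingale_def cadlag_path_def)
  have "AE \<omega> in P. (\<forall>c. \<exists>t\<ge>0. A t \<omega> > c) \<longrightarrow> ((\<lambda>t. M t \<omega>) \<longlongrightarrow> 0) at_top"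
    by (rule tendsto_zero_of_bounded[OF A(1) _ bdd]) (fact A(2) right_cont)+
  then show ?thesis
    using AE_space
  proof eventually_elim
    case (elim \<omega>)
    then show ?case
      using unbounded_of_terminal_value_infinite[of A \<omega>] A(2)[of \<omega>] by simp
  qed
qed

end
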